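(* Let $(X,S)$ and $(X',S')$ be non-degenerate, involutive and braided "set-theoretical" solutions with $X$, $X'$ finite. Assume that $(X,S)$ and $(X',S')$ are isomorphic. Then their structure groups $G$ and $G'$ are t-isomorphic tableau groups, and likewise the monoids with the same presentations are t-isomorphic tableau monoids.
   Context: Let $X$ be a non-empty set and $S:X\times X\to X\times X$ a bijection, written $S(x,y)=(g_x(y),f_y(x))$. $(X,S)$ is non-degenerate if all the maps $f_x,g_x$ are bijective; involutive if $S^2=\mathrm{id}$; braided if $S^{12}S^{23}S^{12}=S^{23}S^{12}S^{23}$ on $X^3$, where $S^{12}=S\times \mathrm{id}_X$, $S^{23}=\mathrm{id}_X\times S$. Write $S(x,y)=(S_1(x,y),S_2(x,y))$. Pairs $(X,S)$ and $(X',S')$ are isomorphic if there is a bijection $\phi:X\to X'$ with $S'(\phi(x),\phi(y))=(\phi(S_1(x,y)),\phi(S_2(x,y)))$ for all $x,y\in X$. The structure group (resp. structure monoid) of $(X,S)$ is the group (resp. monoid) presented by generators $X$ and defining relations $xy=tz$ whenever $S(x,y)=(t,z)$. A tableau monoid is a monoid $M=\operatorname{Mon}\langle X\mid R\rangle$, given with its presentation, such that $X=\{x_1,\dots,x_n\}$ is finite and each side of every relation in $R$ is a word of length $2$. Two tableau monoids $\operatorname{Mon}\langle X\mid R\rangle$ and $\operatorname{Mon}\langle X'\mid R'\rangle$ are t-isomorphic if there is a bijection $s:X\to X'$ such that $x_ix_j=x_kx_l$ is a relation in $R$ if and only if $s(x_i)s(x_j)=s(x_k)s(x_l)$ is a relation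 in $R'$. Tableau groups and t-isomorphism of tableau groups are defined in the same way, with group presentations. *)

theory Defs
  imports "HOL-Algebra.Group"
begin

subsection \<open>Set-theoretical solutions\<close>

text \<open>We write S (x, y) = (g x y, f y x); note the order of the arguments of f.\<close>

definition g_map :: "('a \<times> 'a \<Rightarrow> 'a \<times> 'a) \<Rightarrow> 'a \<Rightarrow> 'a \<Rightarrow> 'a" where
  "g_map S x y = fst (S (x, y))"

definition f_map :: "('a \<times> 'a \<Rightarrow> 'a \<times> 'a) \<Rightarrow> 'a \<Rightarrow> 'a \<Rightarrow> 'a" where
  "f_map S y x = snd (S (x, y))"

definition set_theoretical_solution :: "'a set \<Rightarrow> ('a \<times> 'a \<Rightarrow> 'a \<times> 'a) \<Rightarrow> bool" where
  "set_theoretical_solution X S \<longleftrightarrow> X \<noteq> {} \<and> bij_betw S (X \<times> X) (X \<times> X)"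

definition non_degenerate :: "'a set \<Rightarrow> ('a \<times> 'a \<Rightarrow> 'a \<times> 'a) \<Rightarrow> bool" where
  "non_degenerate X S \<longleftrightarrow>
     (\<forall>x\<in>X. bij_betw (f_map S x) X X \<and> bij_betw (g_map S x) X X)"

definition involutive :: "'a set \<Rightarrow> ('a \<times> 'a \<Rightarrow> 'a \<times> 'a) \<Rightarrow> bool" where
  "involutive X S \<longleftrightarrow> (\<forall>p\<in>X \<times> X. S (S p) = p)"

definition S12 :: "('a \<times> 'a \<Rightarrow> 'a \<times> 'a) \<Rightarrow> 'a \<times> 'a \<times> 'a \<Rightarrow> 'a \<times> 'a \<times> 'a" where
  "S12 S = (\<lambda>(x, y, z). (fst (S (x, y)), snd (S (x, y)), z))"

definition S23 :: "('a \<times> 'a \<Rightarrow> 'a \<times> 'a) \<Rightarrow> 'a \<times> 'a \<times> 'a \<Rightarrow> 'a \<times> 'a \<times> 'a" where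
  "S23 S = (\<lambda>(x, y, z). (x, S (y, z)))"

definition braided :: "'a set \<Rightarrow> ('a \<times> 'a \<Rightarrow> 'a \<times> 'a) \<Rightarrow> bool" where
  "braided X S \<longleftrightarrow>
     (\<forall>p\<in>X \<times> X \<times> X. S12 S (S23 S (S12 S p)) = S23 S (S12 S (S23 S p)))"

definition solutions_isomorphic ::
  "'a set \<Rightarrow> ('a \<times> 'a \<Rightarrow> 'a \<times> 'a) \<Rightarrow> 'b set \<Rightarrow> ('b \<times> 'b \<Rightarrow> 'b \<times> 'b) \<Rightarrow> bool" where
  "solutions_isomorphic X S X' S' \<longleftrightarrow>
     (\<exists>\<phi>. bij_betw \<phi> X X' \<and>
        (\<forall>x\<in>X. \<forall>y\<in>X. S' (\<phi> x, \<phi> y) = (\<phi> (fst (S (x, y))), \<phi> (snd (S (x, y))))))"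


subsection \<open>Monoid and group presentations\<close>

text \<open>The congruence on the free monoid of words over A generated by a set R of
  defining relations, a relation u = v being represented by the pair (u, v).\<close>

inductive_set word_cong :: "'a set \<Rightarrow> ('a list \<times> 'a list) set \<Rightarrow> ('a list \<times> 'a list) set"
  for A :: "'a set" and R :: "('a list \<times> 'a list) set" where
  rel: "(u, v) \<in> R \<Longrightarrow> u \<in> lists A \<Longrightarrow> v \<in> lists A \<Longrightarrow> (u, v) \<in> word_cong A R"
| refl: "u \<in> lists A \<Longrightarrow> (u, u) \<in> word_cong A R"
| sym: "(u, v) \<in> word_cong A R \<Longrightarrow> (v, u) \<in> word_cong A R"
| trans: "(u, v) \<in> word_cong A R \<Longrightarrow> (v, w) \<in> word_cong A R \<Longrightarrow> (u, w) \<in> word_cong A R"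
| append: "(u, v) \<in> word_cong A R \<Longrightarrow> (u', v') \<in> word_cong A R
    \<Longrightarrow> (u @ u', v @ v') \<in> word_cong A R"

definition presented_monoid ::
  "'a set \<Rightarrow> ('a list \<times> 'a list) set \<Rightarrow> 'a list set monoid" where
  "presented_monoid A R =
     \<lparr>carrier = lists A // word_cong A R,
      mult = (\<lambda>U V. \<Union>u\<in>U. \<Union>v\<in>V. word_cong A R `` {u @ v}),
      one = word_cong A R `` {[]}\<rparr>"

text \<open>Group words are words in signed letters: (x, True) stands for the generator x and
  (x, False) for its formal inverse.\<close>

definition presented_group ::
  "'a set \<Rightarrow> (('a \<times> bool) list \<times> ('a \<times> bool) list) set \<Rightarrow> ('a \<times> bool) list set monoid" where
  "presented_group X R =
     presented_monoid (X \<times> UNIV) (R \<union> {([(x, b), (x, \<not> b)], []) | x b. x \<in> X})"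

abbreviation positive_word :: "'a list \<Rightarrow> ('a \<times> bool) list" where
  "positive_word w \<equiv> map (\<lambda>x. (x, True)) w"


subsection \<open>Tableau monoids and tableau groups\<close>

definition tableau_monoid ::
  "'a list set monoid \<Rightarrow> 'a set \<Rightarrow> ('a list \<times> 'a list) set \<Rightarrow> bool" where
  "tableau_monoid M X R \<longleftrightarrow>
     monoid M \<and> M = presented_monoid X R \<and> finite X \<and>
     (\<forall>(u, v)\<in>R. u \<in> lists X \<and> length u = 2 \<and> v \<in> lists X \<and> length v = 2)"

text \<open>In a group presentation the words of length 2 are words in the generators themselves,
  without inverses, as in the monoid case.\<close>

definition tableau_group ::
  "('a \<times> bool) list set monoid \<Rightarrow> 'a set \<Rightarrow> (('a \<times> bool) list \<times> ('a \<times> bool) list) set \<Rightarrow> bool" where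
  "tableau_group G X R \<longleftrightarrow>
     group G \<and> G = presented_group X R \<and> finite X \<and>
     (\<forall>(u, v)\<in>R. u \<in> positive_word ` lists X \<and> length u = 2 \<and>
                 v \<in> positive_word ` lists X \<and> length v = 2)"

text \<open>t-isomorphism is a property of the presentations carried by the monoids or groups.\<close>

definition t_isomorphic_monoids ::
  "'a set \<Rightarrow> ('a list \<times> 'a list) set \<Rightarrow> 'b set \<Rightarrow> ('b list \<times> 'b list) set \<Rightarrow> bool" where
  "t_isomorphic_monoids X R X' R' \<longleftrightarrow>
     (\<exists>s. bij_betw s X X' \<and>
        (\<forall>i\<in>X. \<forall>j\<in>X. \<forall>k\<in>X. \<forall>l\<in>X.
           ([i, j], [k, l]) \<in> R \<longleftrightarrow> ([s i, s j], [s k, s l]) \<in> R'))"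

definition t_isomorphic_groups ::
  "'a set \<Rightarrow> (('a \<times> bool) list \<times> ('a \<times> bool) list) set \<Rightarrow>
   'b set \<Rightarrow> (('b \<times> bool) list \<times> ('b \<times> bool) list) set \<Rightarrow> bool" where
  "t_isomorphic_groups X R X' R' \<longleftrightarrow>
     (\<exists>s. bij_betw s X X' \<and>
        (\<forall>i\<in>X. \<forall>j\<in>X. \<forall>k\<in>X. \<forall>l\<in>X.
           (positive_word [i, j], positive_word [k, l]) \<in> R \<longleftrightarrow>
           (positive_word [s i, s j], positive_word [s k, s l]) \<in> R'))"


subsection \<open>Structure monoid and structure group\<close>

definition monoid_relations ::
  "'a set \<Rightarrow> ('a \<times> 'a \<Rightarrow> 'a \<times> 'a) \<Rightarrow> ('a list \<times> 'a list) set" where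
  "monoid_relations X S =
     {([x, y], [t, z]) | x y t z. x \<in> X \<and> y \<in> X \<and> S (x, y) = (t, z)}"

definition group_relations ::
  "'a set \<Rightarrow> ('a \<times> 'a \<Rightarrow> 'a \<times> 'a) \<Rightarrow> (('a \<times> bool) list \<times> ('a \<times> bool) list) set" where
  "group_relations X S =
     {(positive_word [x, y], positive_word [t, z]) | x y t z.
        x \<in> X \<and> y \<in> X \<and> S (x, y) = (t, z)}"

definition structure_monoid :: "'a set \<Rightarrow> ('a \<times> 'a \<Rightarrow> 'a \<times> 'a) \<Rightarrow> 'a list set monoid" where
  "structure_monoid X S = presented_monoid X (monoid_relations X S)"

definition structure_group :: "'a set \<Rightarrow> ('a \<times> 'a \<Rightarrow> 'a \<times> 'a) \<Rightarrow> ('a \<times> bool) list set monoid" where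
  "structure_group X S = presented_group X (group_relations X S)"

end

theory Submission
  imports Defs
begin

text \<open>A presentation by words determines a monoid because the generated congruence is compatible
  with concatenation; with the relations \<open>x x\<inverse> = 1 = x\<inverse> x\<close> added it determines a group,
  since reversing a word and inverting its letters then gives an inverse
  (\<open>monoid_presented_monoid\<close>, \<open>group_presented_group\<close>). The defining relations of the structure
  monoid and group are nothing but the graph of \<open>S\<close> on \<open>X \<times> X\<close>, each pair being written as a word
  of length 2. As \<open>S\<close> maps \<open>X \<times> X\<close> to itself, both presentations are tableau presentations, and an
  isomorphism of solutions, being a bijection that carries the graph of \<open>S\<close> onto the graph of
  \<open>S'\<close> (\<open>isomorphism_graph_iff\<close>), is itself the required bijection of generators, for the
  groups and the monoids alike.\<close>

lemma word_cong_in_lists: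
  assumes "(u, v) \<in> word_cong A R"
  shows "u \<in> lists A \<and> v \<in> lists A"
  using assms by induction auto

lemma equiv_word_cong: "equiv (lists A) (word_cong A R)"
proof (rule equivI)
  show "word_cong A R \<subseteq> lists A \<times> lists A"
    using word_cong_in_lists by fast
  show "refl_on (lists A) (word_cong A R)"
    by (rule refl_onI) (rule word_cong.refl)
  show "sym (word_cong A R)"
    by (rule symI) (rule word_cong.sym)
  show "trans (word_cong A R)"
    by (rule transI) (rule word_cong.trans)
qed

lemma word_cong_class_eqI:
  "(u, v) \<in> word_cong A R \<Longrightarrow> word_cong A R `` {u} = word_cong A R `` {v}"
  using equiv_word_cong by (rule equiv_class_eq)

lemma word_cong_class_in_carrier:
  "u \<in> lists A \<Longrightarrow> word_cong A R `` {u} \<in> carrier (presented_monoid A R)"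
  by (simp add: presented_monoid_def quotientI)

lemma presented_monoid_carrierE:
  assumes "U \<in> carrier (presented_monoid A R)"
  obtains u where "u \<in> lists A" "U = word_cong A R `` {u}"
  using assms unfolding presented_monoid_def by (simp add: quotient_def) blast

lemma presented_monoid_mult_class:
  assumes "u \<in> lists A" "v \<in> lists A"
  shows "word_cong A R `` {u} \<otimes>\<^bsub>presented_monoid A R\<^esub> word_cong A R `` {v} =
         word_cong A R `` {u @ v}"
proof -
  let ?U = "word_cong A R `` {u}" and ?V = "word_cong A R `` {v}"
  have "word_cong A R `` {u' @ v'} = word_cong A R `` {u @ v}" if "u' \<in> ?U" "v' \<in> ?V" for u' v'
    using that by (intro word_cong_class_eqI word_cong.append) (simp_all add: word_cong.sym)
  then have "(\<Union>u'\<in>?U. \<Union>v'\<in>?V. word_cong A R `` {u' @ v'}) =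
      (\<Union>u'\<in>?U. \<Union>v'\<in>?V. word_cong A R `` {u @ v})"
    by (intro SUP_cong HOL.refl)
  moreover have "u \<in> ?U" "v \<in> ?V"
    using assms by (simp_all add: word_cong.refl)
  then have "?U \<noteq> {}" "?V \<noteq> {}" by blast+
  ultimately show ?thesis
    by (simp only: presented_monoid_def monoid.simps UN_constant if_False)
qed

lemma presented_monoid_one: "\<one>\<^bsub>presented_monoid A R\<^esub> = word_cong A R `` {[]}"
  by (simp add: presented_monoid_def)

lemma monoid_presented_monoid: "monoid (presented_monoid A R)"
  by (rule monoidI; (elim presented_monoid_carrierE)?; hypsubst?)
    (simp_all only: presented_monoid_mult_class presented_monoid_one word_cong_class_in_carrier
      append_in_lists_conv lists.Nil append_assoc append_Nil append_Nil2 simp_thms)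

definition inverse_word :: "('a \<times> bool) list \<Rightarrow> ('a \<times> bool) list" where
  "inverse_word w = rev (map (\<lambda>(x, b). (x, \<not> b)) w)"

lemma inverse_word_in_lists:
  "w \<in> lists (X \<times> UNIV) \<Longrightarrow> inverse_word w \<in> lists (X \<times> UNIV)"
  by (auto simp: inverse_word_def)

text \<open>In the product of the inverse word with the word, the first letter of the word meets its own
  formal inverse in the middle, so that free reductions cancel everything from the inside out.\<close>

lemma inverse_word_cancels:
  assumes "w \<in> lists (X \<times> UNIV)"
    and cancel: "\<And>x b. x \<in> X \<Longrightarrow> ([(x, b), (x, \<not> b)], []) \<in> R"
  shows "(inverse_word w @ w, []) \<in> word_cong (X \<times> UNIV) R"
  using assms(1)
proof (induction w rule: list.induct)
  case Nil
  show ?case by (simp add: inverse_word_def word_cong.refl)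
next
  case (Cons a w)
  obtain x b where a: "a = (x, b)" by (cases a)
  have x: "x \<in> X" and w: "w \<in> lists (X \<times> UNIV)"
    using Cons.prems a by auto
  have "([(x, \<not> b), (x, b)], []) \<in> word_cong (X \<times> UNIV) R"
    using cancel[OF x, of "\<not> b"] x by (intro word_cong.rel) auto
  then have "(inverse_word w @ [(x, \<not> b), (x, b)] @ w, inverse_word w @ [] @ w)
      \<in> word_cong (X \<times> UNIV) R"
    using w inverse_word_in_lists[OF w] by (intro word_cong.append word_cong.refl)
  then have "(inverse_word w @ [(x, \<not> b), (x, b)] @ w, []) \<in> word_cong (X \<times> UNIV) R"
    using word_cong.trans[OF _ Cons.IH[OF w]] by simp
  then show ?case by (simp add: a inverse_word_def)
qed

lemma group_presented_group: "group (presented_group X R)"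
  unfolding presented_group_def
proof (rule monoid.group_l_invI[OF monoid_presented_monoid])
  let ?R = "R \<union> {([(x, b), (x, \<not> b)], []) | x b. x \<in> X}"
  let ?M = "presented_monoid (X \<times> UNIV) ?R"
  fix U assume "U \<in> carrier ?M"
  then obtain u where u: "u \<in> lists (X \<times> UNIV)" "U = word_cong (X \<times> UNIV) ?R `` {u}"
    by (rule presented_monoid_carrierE)
  let ?V = "word_cong (X \<times> UNIV) ?R `` {inverse_word u}"
  have "(inverse_word u @ u, []) \<in> word_cong (X \<times> UNIV) ?R"
    by (rule inverse_word_cancels[OF u(1)]) auto
  then have "?V \<otimes>\<^bsub>?M\<^esub> U = \<one>\<^bsub>?M\<^esub>"
    unfolding u(2) presented_monoid_mult_class[OF inverse_word_in_lists[OF u(1)] u(1)]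
      presented_monoid_one
    by (rule word_cong_class_eqI)
  then show "\<exists>V\<in>carrier ?M. V \<otimes>\<^bsub>?M\<^esub> U = \<one>\<^bsub>?M\<^esub>"
    using word_cong_class_in_carrier[OF inverse_word_in_lists[OF u(1)]] by blast
qed

lemma set_theoretical_solution_closed:
  assumes "set_theoretical_solution X S" "x \<in> X" "y \<in> X" "S (x, y) = (t, z)"
  shows "t \<in> X \<and> z \<in> X"
proof -
  have "S (x, y) \<in> X \<times> X"
    using assms(1-3) bij_betw_apply[of S "X \<times> X" "X \<times> X" "(x, y)"]
    by (simp add: set_theoretical_solution_def)
  then show ?thesis using assms(4) by simp
qed

lemma tableau_structure_monoid:
  assumes "set_theoretical_solution X S" "finite X"
  shows "tableau_monoid (structure_monoid X S) X (monoid_relations X S)"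
  using assms(2) unfolding tableau_monoid_def structure_monoid_def monoid_relations_def
  by (auto simp: monoid_presented_monoid dest: set_theoretical_solution_closed[OF assms(1)])

lemma tableau_structure_group:
  assumes "set_theoretical_solution X S" "finite X"
  shows "tableau_group (structure_group X S) X (group_relations X S)"
proof -
  have "u \<in> positive_word ` lists X \<and> length u = 2 \<and> v \<in> positive_word ` lists X \<and> length v = 2"
    if uv: "(u, v) \<in> group_relations X S" for u v
  proof -
    obtain x y t z where "u = positive_word [x, y]" "v = positive_word [t, z]"
      and xy: "x \<in> X" "y \<in> X" and "S (x, y) = (t, z)"
      using uv unfolding group_relations_def by blast
    moreover have "[x, y] \<in> lists X" "[t, z] \<in> lists X"
      using xy set_theoretical_solution_closed[OF assms(1) xy \<open>S (x, y) = (t, z)\<close>] by auto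
    ultimately show ?thesis by (metis imageI length_Cons length_map list.size(3) numeral_2_eq_2)
  qed
  then show ?thesis
    using assms(2) unfolding tableau_group_def structure_group_def
    by (auto simp: group_presented_group)
qed

lemma monoid_relations_iff:
  "([i, j], [k, l]) \<in> monoid_relations X S \<longleftrightarrow> i \<in> X \<and> j \<in> X \<and> S (i, j) = (k, l)"
  by (auto simp: monoid_relations_def)

lemma group_relations_iff:
  "(positive_word [i, j], positive_word [k, l]) \<in> group_relations X S \<longleftrightarrow>
   i \<in> X \<and> j \<in> X \<and> S (i, j) = (k, l)"
  by (auto simp: group_relations_def)

text \<open>Injectivity of \<open>\<phi>\<close> is what makes the relations of \<open>S'\<close> reflect those of \<open>S\<close>.\<close>

lemma isomorphism_graph_iff:
  assumes "set_theoretical_solution X S" "inj_on \<phi> X"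
    and hom: "\<forall>x\<in>X. \<forall>y\<in>X. S' (\<phi> x, \<phi> y) = (\<phi> (fst (S (x, y))), \<phi> (snd (S (x, y))))"
    and "i \<in> X" "j \<in> X" "k \<in> X" "l \<in> X"
  shows "S (i, j) = (k, l) \<longleftrightarrow> S' (\<phi> i, \<phi> j) = (\<phi> k, \<phi> l)"
proof -
  obtain t z where tz: "S (i, j) = (t, z)" by (cases "S (i, j)")
  then have "t \<in> X" "z \<in> X"
    using set_theoretical_solution_closed[OF assms(1)] assms(4,5) by blast+
  moreover have "S' (\<phi> i, \<phi> j) = (\<phi> t, \<phi> z)"
    using hom assms(4,5) tz by simp
  ultimately show ?thesis
    using tz assms(6,7) inj_on_eq_iff[OF assms(2)] by simp
qed

theorem claim8p12:
  fixes X :: "'a set" and S :: "'a \<times> 'a \<Rightarrow> 'a \<times> 'a"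
    and X' :: "'b set" and S' :: "'b \<times> 'b \<Rightarrow> 'b \<times> 'b"
  assumes "set_theoretical_solution X S" "non_degenerate X S" "involutive X S" "braided X S"
    and "set_theoretical_solution X' S'" "non_degenerate X' S'" "involutive X' S'" "braided X' S'"
    and "finite X" and "finite X'"
    and "solutions_isomorphic X S X' S'"
  shows "(tableau_group (structure_group X S) X (group_relations X S) \<and>
          tableau_group (structure_group X' S') X' (group_relations X' S') \<and>
          t_isomorphic_groups X (group_relations X S) X' (group_relations X' S')) \<and>
         (tableau_monoid (structure_monoid X S) X (monoid_relations X S) \<and>
          tableau_monoid (structure_monoid X' S') X' (monoid_relations X' S') \<and>
          t_isomorphic_monoids X (monoid_relations X S) X' (monoid_relations X' S'))"
proof -
  obtain \<phi> where bij: "bij_betw \<phi> X X'"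
    and hom: "\<forall>x\<in>X. \<forall>y\<in>X. S' (\<phi> x, \<phi> y) = (\<phi> (fst (S (x, y))), \<phi> (snd (S (x, y))))"
    using assms(11) unfolding solutions_isomorphic_def by blast
  have graph: "i \<in> X \<and> j \<in> X \<and> S (i, j) = (k, l) \<longleftrightarrow>
      \<phi> i \<in> X' \<and> \<phi> j \<in> X' \<and> S' (\<phi> i, \<phi> j) = (\<phi> k, \<phi> l)"
    if "i \<in> X" "j \<in> X" "k \<in> X" "l \<in> X" for i j k l
    using isomorphism_graph_iff[OF assms(1) bij_betw_imp_inj_on[OF bij] hom that]
      bij_betwE[OF bij] that by blast
  have "t_isomorphic_groups X (group_relations X S) X' (group_relations X' S')"
    unfolding t_isomorphic_groups_def group_relations_iff using bij graph by blast
  moreover have "t_isomorphic_monoids X (monoid_relations X S) X' (monoid_relations X' S')"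
    unfolding t_isomorphic_monoids_def monoid_relations_iff using bij graph by blast
  ultimately show ?thesis
    using assms(1,5,9,10) by (simp add: tableau_structure_monoid tableau_structure_group)
qed

end
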